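(* Let $\tau>0$, and integers $n\ge1$, $d\ge0$. Let $A$ be a compact Hermitian operator on $\mathcal C_\tau$ which is positive on the subspace $$Y_d=\{p\in\mathcal C_\tau:\ p\text{ is an }n\text{-dimensional vector of univariate polynomials of degree }d\text{ or less}\}.$$ Then there exists a positive semidefinite matrix $Q\in\mathbb S^{n(d+1)}$ such that $$\langle x,Ax\rangle=\int_{-\tau}^0\int_{-\tau}^0x(\theta)^Tk(\theta,\omega)x(\omega)\,d\theta\,d\omega\quad\text{for all }x\in Y_d,\qquad k(\theta,\omega)=\bar Z_d^n(\theta)^T\,Q\,\bar Z_d^n(\omega).$$
   Context: $\mathcal C_\tau$ is the space of continuous functions $[-\tau,0]\to\mathbb R^n$, regarded here as an inner product space with the $L_2$ inner product $\langle x,y\rangle=\int_{-\tau}^0x(\theta)^Ty(\theta)\,d\theta$. An operator $A$ is positive on a subset $Y$ if $\langle x,Ax\rangle\ge0$ for all $x\in Y$. $\mathbb S^m$ is the space of real symmetric $m\times m$ matrices. $Z_d(\theta)=(1,\theta,\dots,\theta^d)^T$ and $\bar Z_d^n(\theta)=I_n\otimes Z_d(\theta)$, an $n(d+1)\times n$ block-diagonal matrix. *)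

theory Defs
  imports
    "HOL-Analysis.Henstock_Kurzweil_Integration"
    "HOL-Computational_Algebra.Polynomial"
    "HOL-Library.FuncSet"
    "Jordan_Normal_Form.Matrix"
begin

text \<open>
  Functions on \<open>[-\<tau>, 0]\<close> are extensional: they take the value \<open>undefined\<close> outside the interval,
  so that HOL equality of two elements of \<open>C_space n \<tau>\<close> is equality on \<open>[-\<tau>, 0]\<close>. Since the type
  of vectors carries no topology, continuity is required of each component.
\<close>

definition C_space :: "nat \<Rightarrow> real \<Rightarrow> (real \<Rightarrow> real vec) set" where
  "C_space n \<tau> = {x \<in> {-\<tau>..0} \<rightarrow>\<^sub>E carrier_vec n.
     \<forall>i<n. continuous_on {-\<tau>..0} (\<lambda>\<theta>. x \<theta> $ i)}"

definition add_fun :: "real \<Rightarrow> (real \<Rightarrow> real vec) \<Rightarrow> (real \<Rightarrow> real vec) \<Rightarrow> real \<Rightarrow> real vec" where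
  "add_fun \<tau> x y = (\<lambda>\<theta>\<in>{-\<tau>..0}. x \<theta> + y \<theta>)"

definition diff_fun :: "real \<Rightarrow> (real \<Rightarrow> real vec) \<Rightarrow> (real \<Rightarrow> real vec) \<Rightarrow> real \<Rightarrow> real vec" where
  "diff_fun \<tau> x y = (\<lambda>\<theta>\<in>{-\<tau>..0}. x \<theta> - y \<theta>)"

definition smult_fun :: "real \<Rightarrow> real \<Rightarrow> (real \<Rightarrow> real vec) \<Rightarrow> real \<Rightarrow> real vec" where
  "smult_fun \<tau> c x = (\<lambda>\<theta>\<in>{-\<tau>..0}. c \<cdot>\<^sub>v x \<theta>)"

definition L2_inner :: "real \<Rightarrow> (real \<Rightarrow> real vec) \<Rightarrow> (real \<Rightarrow> real vec) \<Rightarrow> real" where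
  "L2_inner \<tau> x y = integral {-\<tau>..0} (\<lambda>\<theta>. x \<theta> \<bullet> y \<theta>)"

definition L2_norm :: "real \<Rightarrow> (real \<Rightarrow> real vec) \<Rightarrow> real" where
  "L2_norm \<tau> x = sqrt (L2_inner \<tau> x x)"

definition linear_operator ::
    "nat \<Rightarrow> real \<Rightarrow> ((real \<Rightarrow> real vec) \<Rightarrow> real \<Rightarrow> real vec) \<Rightarrow> bool" where
  "linear_operator n \<tau> A \<longleftrightarrow>
     A \<in> C_space n \<tau> \<rightarrow> C_space n \<tau> \<and>
     (\<forall>x\<in>C_space n \<tau>. \<forall>y\<in>C_space n \<tau>. A (add_fun \<tau> x y) = add_fun \<tau> (A x) (A y)) \<and>
     (\<forall>c. \<forall>x\<in>C_space n \<tau>. A (smult_fun \<tau> c x) = smult_fun \<tau> c (A x))"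

text \<open>
  Compactness is with respect to the \<open>L\<^sub>2\<close> norm on the (incomplete) space of continuous functions;
  in particular the limit below has to be a continuous function.
\<close>

definition compact_operator ::
    "nat \<Rightarrow> real \<Rightarrow> ((real \<Rightarrow> real vec) \<Rightarrow> real \<Rightarrow> real vec) \<Rightarrow> bool" where
  "compact_operator n \<tau> A \<longleftrightarrow>
     linear_operator n \<tau> A \<and>
     (\<forall>X :: nat \<Rightarrow> real \<Rightarrow> real vec.
        (\<forall>k. X k \<in> C_space n \<tau>) \<and> (\<exists>B. \<forall>k. L2_norm \<tau> (X k) \<le> B) \<longrightarrow>
        (\<exists>r y. strict_mono (r :: nat \<Rightarrow> nat) \<and> y \<in> C_space n \<tau> \<and>
           (\<lambda>k. L2_norm \<tau> (diff_fun \<tau> (A (X (r k))) y)) \<longlonglongrightarrow> 0))"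

definition hermitian_operator ::
    "nat \<Rightarrow> real \<Rightarrow> ((real \<Rightarrow> real vec) \<Rightarrow> real \<Rightarrow> real vec) \<Rightarrow> bool" where
  "hermitian_operator n \<tau> A \<longleftrightarrow>
     linear_operator n \<tau> A \<and>
     (\<forall>x\<in>C_space n \<tau>. \<forall>y\<in>C_space n \<tau>. L2_inner \<tau> (A x) y = L2_inner \<tau> x (A y))"

definition positive_on ::
    "real \<Rightarrow> (real \<Rightarrow> real vec) set \<Rightarrow> ((real \<Rightarrow> real vec) \<Rightarrow> real \<Rightarrow> real vec) \<Rightarrow> bool" where
  "positive_on \<tau> Y A \<longleftrightarrow> (\<forall>x\<in>Y. 0 \<le> L2_inner \<tau> x (A x))"

definition poly_space :: "nat \<Rightarrow> real \<Rightarrow> nat \<Rightarrow> (real \<Rightarrow> real vec) set" where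
  "poly_space n \<tau> d = {p \<in> C_space n \<tau>.
     \<exists>q :: nat \<Rightarrow> real poly. \<forall>i<n. degree (q i) \<le> d \<and> (\<forall>\<theta>\<in>{-\<tau>..0}. p \<theta> $ i = poly (q i) \<theta>)}"

definition sym_mats :: "nat \<Rightarrow> real mat set" where
  "sym_mats m = {Q \<in> carrier_mat m m. transpose_mat Q = Q}"

definition psd_mat :: "real mat \<Rightarrow> bool" where
  "psd_mat Q \<longleftrightarrow> (\<forall>v\<in>carrier_vec (dim_row Q). 0 \<le> v \<bullet> (Q *\<^sub>v v))"

definition kronecker_prod :: "real mat \<Rightarrow> real mat \<Rightarrow> real mat" where
  "kronecker_prod A B = mat (dim_row A * dim_row B) (dim_col A * dim_col B)
     (\<lambda>(i, j). A $$ (i div dim_row B, j div dim_col B) * B $$ (i mod dim_row B, j mod dim_col B))"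

definition Z :: "nat \<Rightarrow> real \<Rightarrow> real mat" where
  "Z d \<theta> = mat (d + 1) 1 (\<lambda>(i, j). \<theta> ^ i)"

definition Zbar :: "nat \<Rightarrow> nat \<Rightarrow> real \<Rightarrow> real mat" where
  "Zbar n d \<theta> = kronecker_prod (1\<^sub>m n) (Z d \<theta>)"

end

theory Submission
  imports Defs "HOL-Analysis.Equivalence_Lebesgue_Henstock_Integration"
    "Jordan_Normal_Form.Determinant"
begin

text \<open>
  On the finite-dimensional space \<open>Y_d\<close> the quadratic form of \<open>A\<close> is that of a matrix, and any such
  form can be rewritten as a form in the moments of \<open>x\<close>, which is what a polynomial kernel computes.

  Let \<open>m = n (d + 1)\<close> and let \<open>e\<^sub>0, \<dots>, e\<^sub>m\<^sub>-\<^sub>1\<close> be the rows of \<open>Zbar\<close>; these are the vector monomials and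
  they form a basis of \<open>Y_d\<close> (\<open>poly_space_eq_lin_comb\<close>, \<open>block_monomials_independent\<close>). Put
  \<open>M = (\<langle>e\<^sub>a, A e\<^sub>b\<rangle>)\<close> and let \<open>G = (\<langle>e\<^sub>a, e\<^sub>b\<rangle>)\<close> be the Gram matrix. For \<open>x = \<Sum> c\<^sub>a e\<^sub>a\<close> one has
  \<open>\<langle>x, A x\<rangle> = c \<bullet> M c\<close> (\<open>quadratic_form_eq_form_matrix\<close>), while the kernel of a matrix \<open>Q\<close> gives
  \<open>w \<bullet> Q w\<close> with the moment vector \<open>w = (\<langle>e\<^sub>a, x\<rangle>) = G c\<close> (\<open>double_integral_eq_moment_form\<close>). The Gram
  matrix of a basis has a left inverse \<open>H\<close> (\<open>gram_matrix_left_inverse\<close>), so \<open>c = H w\<close> and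
  \<open>Q = H\<^sup>T M H\<close> makes the two forms agree. As a congruence transform of \<open>M\<close>, this \<open>Q\<close> inherits symmetry
  from \<open>A\<close> being Hermitian, and positivity from \<open>A\<close> being positive on \<open>Y_d\<close>: the vector \<open>H v\<close> is
  the coefficient vector of an element of \<open>Y_d\<close>, whatever \<open>v\<close> is.
\<close>

unbundle no vec_syntax
unbundle no inner_syntax

section \<open>The inner product space of continuous functions\<close>

lemma scalar_prod_transpose_mult_vec:
  fixes B :: "'a :: comm_semiring_0 mat"
  assumes "B \<in> carrier_mat r k" "x \<in> carrier_vec k" "y \<in> carrier_vec r"
  shows "x \<bullet> (transpose_mat B *\<^sub>v y) = (B *\<^sub>v x) \<bullet> y"
proof -
  have "x \<bullet> (transpose_mat B *\<^sub>v y) = (transpose_mat B *\<^sub>v y) \<bullet> x"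
    by (rule comm_scalar_prod[of _ k])
      (use assms in \<open>auto intro: mult_mat_vec_carrier[of _ _ r]\<close>)
  also have "\<dots> = y \<bullet> (B *\<^sub>v x)"
    by (rule transpose_vec_mult_scalar[OF assms])
  also have "\<dots> = (B *\<^sub>v x) \<bullet> y"
    by (rule comm_scalar_prod[of _ r])
      (use assms in \<open>auto intro: mult_mat_vec_carrier[of _ _ k]\<close>)
  finally show ?thesis .
qed

lemma C_spaceD:
  assumes "x \<in> C_space n \<tau>"
  shows "\<And>\<theta>. \<theta> \<in> {-\<tau>..0} \<Longrightarrow> x \<theta> \<in> carrier_vec n"
    and "\<And>\<theta>. \<theta> \<in> {-\<tau>..0} \<Longrightarrow> dim_vec (x \<theta>) = n"
    and "\<And>i. i < n \<Longrightarrow> continuous_on {-\<tau>..0} (\<lambda>\<theta>. x \<theta> $ i)"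
  using assms unfolding C_space_def by (fastforce simp: PiE_iff)+

lemma C_space_restrictI:
  assumes "\<And>\<theta>. \<theta> \<in> {-\<tau>..0} \<Longrightarrow> f \<theta> \<in> carrier_vec n"
    and "\<And>i. i < n \<Longrightarrow> continuous_on {-\<tau>..0} (\<lambda>\<theta>. f \<theta> $ i)"
  shows "restrict f {-\<tau>..0} \<in> C_space n \<tau>"
  unfolding C_space_def
proof (intro CollectI conjI allI impI)
  show "restrict f {-\<tau>..0} \<in> {-\<tau>..0} \<rightarrow>\<^sub>E carrier_vec n"
    using assms(1) by auto
  fix i assume "i < n"
  from assms(2)[OF this] show "continuous_on {-\<tau>..0} (\<lambda>\<theta>. restrict f {-\<tau>..0} \<theta> $ i)"
    by (rule continuous_on_eq) simp
qed

lemma C_space_eqI: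
  assumes "x \<in> C_space n \<tau>" "y \<in> C_space n \<tau>"
    and "\<And>\<theta> i. \<theta> \<in> {-\<tau>..0} \<Longrightarrow> i < n \<Longrightarrow> x \<theta> $ i = y \<theta> $ i"
  shows "x = y"
proof
  fix \<theta>
  show "x \<theta> = y \<theta>"
  proof (cases "\<theta> \<in> {-\<tau>..0}")
    case True
    show ?thesis
      using C_spaceD(2)[OF assms(1) True] C_spaceD(2)[OF assms(2) True] assms(3)[OF True]
      by (intro eq_vecI) auto
  next
    case False
    then show ?thesis
      using assms(1,2) unfolding C_space_def by (auto simp: PiE_iff extensional_def)
  qed
qed

lemma add_fun_C_space:
  assumes "x \<in> C_space n \<tau>" "y \<in> C_space n \<tau>"
  shows "add_fun \<tau> x y \<in> C_space n \<tau>"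
  unfolding add_fun_def
proof (rule C_space_restrictI)
  show "x \<theta> + y \<theta> \<in> carrier_vec n" if "\<theta> \<in> {-\<tau>..0}" for \<theta>
    using C_spaceD(1)[OF assms(1) that] C_spaceD(1)[OF assms(2) that] by simp
  fix i assume i: "i < n"
  have "continuous_on {-\<tau>..0} (\<lambda>\<theta>. x \<theta> $ i + y \<theta> $ i)"
    by (intro continuous_intros C_spaceD(3)[OF assms(1) i] C_spaceD(3)[OF assms(2) i])
  then show "continuous_on {-\<tau>..0} (\<lambda>\<theta>. (x \<theta> + y \<theta>) $ i)"
    by (rule continuous_on_eq) (use i C_spaceD(2)[OF assms(2)] in auto)
qed

lemma smult_fun_C_space:
  assumes "x \<in> C_space n \<tau>"
  shows "smult_fun \<tau> c x \<in> C_space n \<tau>"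
  unfolding smult_fun_def
proof (rule C_space_restrictI)
  show "c \<cdot>\<^sub>v x \<theta> \<in> carrier_vec n" if "\<theta> \<in> {-\<tau>..0}" for \<theta>
    using C_spaceD(1)[OF assms that] by simp
  fix i assume i: "i < n"
  have "continuous_on {-\<tau>..0} (\<lambda>\<theta>. c * x \<theta> $ i)"
    by (intro continuous_intros C_spaceD(3)[OF assms i])
  then show "continuous_on {-\<tau>..0} (\<lambda>\<theta>. (c \<cdot>\<^sub>v x \<theta>) $ i)"
    by (rule continuous_on_eq) (use i C_spaceD(2)[OF assms] in auto)
qed

lemma continuous_on_scalar_prod:
  assumes "x \<in> C_space n \<tau>" "y \<in> C_space n \<tau>"
  shows "continuous_on {-\<tau>..0} (\<lambda>\<theta>. x \<theta> \<bullet> y \<theta>)"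
proof -
  have "continuous_on {-\<tau>..0} (\<lambda>\<theta>. \<Sum>i<n. x \<theta> $ i * y \<theta> $ i)"
    by (intro continuous_intros C_spaceD(3)[OF assms(1)] C_spaceD(3)[OF assms(2)]) auto
  then show ?thesis
    by (rule continuous_on_eq)
      (use C_spaceD(2)[OF assms(2)] in \<open>simp add: scalar_prod_def atLeast0LessThan\<close>)
qed

lemma L2_inner_commute:
  assumes "x \<in> C_space n \<tau>" "y \<in> C_space n \<tau>"
  shows "L2_inner \<tau> x y = L2_inner \<tau> y x"
  unfolding L2_inner_def
  by (intro integral_cong comm_scalar_prod[of _ n] C_spaceD(1)[OF assms(1)] C_spaceD(1)[OF assms(2)])

lemma L2_inner_add_right:
  assumes "x \<in> C_space n \<tau>" "y \<in> C_space n \<tau>" "z \<in> C_space n \<tau>"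
  shows "L2_inner \<tau> x (add_fun \<tau> y z) = L2_inner \<tau> x y + L2_inner \<tau> x z"
proof -
  have "L2_inner \<tau> x (add_fun \<tau> y z) = integral {-\<tau>..0} (\<lambda>\<theta>. x \<theta> \<bullet> y \<theta> + x \<theta> \<bullet> z \<theta>)"
    unfolding L2_inner_def add_fun_def
  proof (rule integral_cong)
    fix \<theta> assume t: "\<theta> \<in> {-\<tau>..0}"
    then show "x \<theta> \<bullet> restrict (\<lambda>\<theta>. y \<theta> + z \<theta>) {-\<tau>..0} \<theta> = x \<theta> \<bullet> y \<theta> + x \<theta> \<bullet> z \<theta>"
      using scalar_prod_add_distrib[OF C_spaceD(1)[OF assms(1) t] C_spaceD(1)[OF assms(2) t]
          C_spaceD(1)[OF assms(3) t]] by simp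
  qed
  also have "\<dots> = L2_inner \<tau> x y + L2_inner \<tau> x z"
    unfolding L2_inner_def
    by (intro Henstock_Kurzweil_Integration.integral_add integrable_continuous_interval
        continuous_on_scalar_prod[OF assms(1,2)] continuous_on_scalar_prod[OF assms(1,3)])
  finally show ?thesis .
qed

lemma L2_inner_smult_right:
  assumes "x \<in> C_space n \<tau>" "y \<in> C_space n \<tau>"
  shows "L2_inner \<tau> x (smult_fun \<tau> c y) = c * L2_inner \<tau> x y"
proof -
  have "L2_inner \<tau> x (smult_fun \<tau> c y) = integral {-\<tau>..0} (\<lambda>\<theta>. c * (x \<theta> \<bullet> y \<theta>))"
    unfolding L2_inner_def smult_fun_def
  proof (rule integral_cong)
    fix \<theta> assume t: "\<theta> \<in> {-\<tau>..0}"
    then show "x \<theta> \<bullet> restrict (\<lambda>\<theta>. c \<cdot>\<^sub>v y \<theta>) {-\<tau>..0} \<theta> = c * (x \<theta> \<bullet> y \<theta>)"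
      using scalar_prod_smult_distrib[OF C_spaceD(1)[OF assms(1) t] C_spaceD(1)[OF assms(2) t]]
      by simp
  qed
  then show ?thesis unfolding L2_inner_def by simp
qed

text \<open>
  Continuity makes the \<open>L\<^sub>2\<close> inner product definite: a continuous nonnegative integrand with
  vanishing integral vanishes at every point of the interval.
\<close>
lemma L2_inner_self_eq_0D:
  assumes "\<tau> > 0" "x \<in> C_space n \<tau>" "L2_inner \<tau> x x = 0" "\<theta> \<in> {-\<tau>..0}" "i < n"
  shows "x \<theta> $ i = 0"
proof -
  have cont: "continuous_on {-\<tau>..0} (\<lambda>\<theta>. x \<theta> \<bullet> x \<theta>)"
    by (rule continuous_on_scalar_prod[OF assms(2,2)])
  have "0 \<le> x t \<bullet> x t" for t
    by (simp add: scalar_prod_def sum_nonneg)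
  then have "x \<theta> \<bullet> x \<theta> = 0"
    using integral_eq_0_iff[OF cont] assms(1,3,4) unfolding L2_inner_def by auto
  then have "(\<Sum>j<n. x \<theta> $ j * x \<theta> $ j) = 0"
    using C_spaceD(2)[OF assms(2,4)] by (simp add: scalar_prod_def atLeast0LessThan)
  then show ?thesis
    using assms(5) by (subst (asm) sum_nonneg_eq_0_iff) auto
qed

section \<open>Coordinates and matrices of quadratic forms\<close>

definition lin_comb :: "nat \<Rightarrow> real \<Rightarrow> nat \<Rightarrow> (nat \<Rightarrow> real \<Rightarrow> real vec) \<Rightarrow> real vec \<Rightarrow> real \<Rightarrow> real vec" where
  "lin_comb n \<tau> m e c = (\<lambda>\<theta>\<in>{-\<tau>..0}. vec n (\<lambda>i. \<Sum>a<m. c $ a * e a \<theta> $ i))"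

text \<open>With the identity in place of \<open>A\<close> this is the Gram matrix of \<open>e\<close>.\<close>

definition form_matrix ::
    "real \<Rightarrow> nat \<Rightarrow> (nat \<Rightarrow> real \<Rightarrow> real vec) \<Rightarrow> ((real \<Rightarrow> real vec) \<Rightarrow> real \<Rightarrow> real vec) \<Rightarrow> real mat" where
  "form_matrix \<tau> m e A = mat m m (\<lambda>(a, b). L2_inner \<tau> (e a) (A (e b)))"

lemma lin_comb_C_space:
  assumes "\<And>a. a < m \<Longrightarrow> e a \<in> C_space n \<tau>"
  shows "lin_comb n \<tau> m e c \<in> C_space n \<tau>"
  unfolding lin_comb_def
proof (rule C_space_restrictI)
  fix i assume i: "i < n"
  have "continuous_on {-\<tau>..0} (\<lambda>\<theta>. \<Sum>a<m. c $ a * e a \<theta> $ i)"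
    by (intro continuous_intros C_spaceD(3)[OF assms _ ] i) auto
  then show "continuous_on {-\<tau>..0} (\<lambda>\<theta>. vec n (\<lambda>i. \<Sum>a<m. c $ a * e a \<theta> $ i) $ i)"
    using i by simp
qed simp

text \<open>
  Instances with the identity operator give linearity of the inner product itself, so that moments
  and matrix entries of \<open>A\<close> are handled by the same lemma.
\<close>
lemma L2_inner_lin_comb:
  assumes "linear_operator n \<tau> A" "y \<in> C_space n \<tau>"
    and "\<And>a. a < m \<Longrightarrow> e a \<in> C_space n \<tau>"
  shows "L2_inner \<tau> y (A (lin_comb n \<tau> m e c)) = (\<Sum>a<m. c $ a * L2_inner \<tau> y (A (e a)))"
  using assms(3)
proof (induction m)
  case 0
  \<comment> \<open>The zero function is written as a multiple of \<open>y\<close>, so that homogeneity gives its image.\<close>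
  have "lin_comb n \<tau> 0 e c \<in> C_space n \<tau>" "smult_fun \<tau> 0 y \<in> C_space n \<tau>"
    by (simp_all add: lin_comb_C_space smult_fun_C_space assms(2))
  then have "lin_comb n \<tau> 0 e c = smult_fun \<tau> 0 y"
    by (rule C_space_eqI) (use C_spaceD(2)[OF assms(2)] in \<open>auto simp: lin_comb_def smult_fun_def\<close>)
  then have "A (lin_comb n \<tau> 0 e c) = smult_fun \<tau> 0 (A y)"
    using assms(1,2) unfolding linear_operator_def by simp
  moreover have "A y \<in> C_space n \<tau>"
    using assms(1,2) unfolding linear_operator_def by auto
  ultimately show ?case using L2_inner_smult_right[OF assms(2), of "A y" 0] by simp
next
  case (Suc m)
  have e: "e a \<in> C_space n \<tau>" if "a \<le> m" for a using Suc.prems that by simp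
  have l: "lin_comb n \<tau> m e c \<in> C_space n \<tau>" by (rule lin_comb_C_space) (simp add: e)
  have s: "smult_fun \<tau> (c $ m) (e m) \<in> C_space n \<tau>" by (intro smult_fun_C_space e) simp
  have "lin_comb n \<tau> (Suc m) e c \<in> C_space n \<tau>"
    by (intro lin_comb_C_space e) simp
  then have "lin_comb n \<tau> (Suc m) e c = add_fun \<tau> (lin_comb n \<tau> m e c) (smult_fun \<tau> (c $ m) (e m))"
    by (rule C_space_eqI[OF _ add_fun_C_space[OF l s]])
      (use C_spaceD(2)[OF e[OF order_refl]] in \<open>auto simp: lin_comb_def smult_fun_def add_fun_def\<close>)
  moreover have Am: "A (lin_comb n \<tau> m e c) \<in> C_space n \<tau>" "A (e m) \<in> C_space n \<tau>"
    using assms(1) l e[of m] unfolding linear_operator_def by auto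
  ultimately have "A (lin_comb n \<tau> (Suc m) e c)
      = add_fun \<tau> (A (lin_comb n \<tau> m e c)) (smult_fun \<tau> (c $ m) (A (e m)))"
    using assms(1) l s e[of m] unfolding linear_operator_def by simp
  then show ?case
    using Suc.IH Suc.prems Am
    by (simp add: L2_inner_add_right[OF assms(2) _ smult_fun_C_space]
        L2_inner_smult_right[OF assms(2)])
qed

lemma linear_operator_id: "linear_operator n \<tau> (\<lambda>x. x)"
  unfolding linear_operator_def by auto

text \<open>For the identity operator: the Gram matrix sends coefficients to moments.\<close>
lemma form_matrix_mult_vec:
  assumes "linear_operator n \<tau> A" "\<And>a. a < m \<Longrightarrow> e a \<in> C_space n \<tau>" "c \<in> carrier_vec m" "a < m"
  shows "(form_matrix \<tau> m e A *\<^sub>v c) $ a = L2_inner \<tau> (e a) (A (lin_comb n \<tau> m e c))"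
  using L2_inner_lin_comb[OF assms(1) assms(2)[OF assms(4)] assms(2), of m _ c] assms(3,4)
  by (simp add: form_matrix_def scalar_prod_def atLeast0LessThan mult.commute)

lemma quadratic_form_eq_form_matrix:
  assumes "linear_operator n \<tau> A" "\<And>a. a < m \<Longrightarrow> e a \<in> C_space n \<tau>" "c \<in> carrier_vec m"
  shows "L2_inner \<tau> (lin_comb n \<tau> m e c) (A (lin_comb n \<tau> m e c)) = c \<bullet> (form_matrix \<tau> m e A *\<^sub>v c)"
proof -
  let ?x = "lin_comb n \<tau> m e c"
  have x: "?x \<in> C_space n \<tau>" using assms(2) by (rule lin_comb_C_space)
  have Ax: "A ?x \<in> C_space n \<tau>" using assms(1) x unfolding linear_operator_def by auto
  have "L2_inner \<tau> ?x (A ?x) = L2_inner \<tau> (A ?x) ?x"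
    by (rule L2_inner_commute[OF x Ax])
  also have "\<dots> = (\<Sum>a<m. c $ a * L2_inner \<tau> (A ?x) (e a))"
    by (rule L2_inner_lin_comb[OF linear_operator_id Ax assms(2)])
  also have "\<dots> = (\<Sum>a<m. c $ a * (form_matrix \<tau> m e A *\<^sub>v c) $ a)"
    using form_matrix_mult_vec[OF assms] L2_inner_commute[OF Ax assms(2)] by simp
  also have "\<dots> = c \<bullet> (form_matrix \<tau> m e A *\<^sub>v c)"
    by (simp add: scalar_prod_def atLeast0LessThan form_matrix_def)
  finally show ?thesis .
qed

lemma form_matrix_symmetric:
  assumes "hermitian_operator n \<tau> A" "\<And>a. a < m \<Longrightarrow> e a \<in> C_space n \<tau>"
  shows "transpose_mat (form_matrix \<tau> m e A) = form_matrix \<tau> m e A"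
proof -
  have "L2_inner \<tau> (e b) (A (e a)) = L2_inner \<tau> (e a) (A (e b))" if "a < m" "b < m" for a b
  proof -
    have "A (e b) \<in> C_space n \<tau>"
      using assms that unfolding hermitian_operator_def linear_operator_def by auto
    then show ?thesis
      using assms(1) assms(2)[OF that(1)] assms(2)[OF that(2)]
      unfolding hermitian_operator_def by (metis L2_inner_commute)
  qed
  then show ?thesis unfolding form_matrix_def by (intro eq_matI) auto
qed

text \<open>
  If the Gram matrix annihilates \<open>c\<close>, then the combination with coefficients \<open>c\<close> has norm zero, so
  it vanishes identically and \<open>c\<close> is zero by independence.
\<close>
lemma gram_matrix_left_inverse:
  assumes "\<tau> > 0" "\<And>a. a < m \<Longrightarrow> e a \<in> C_space n \<tau>"
    and indep: "\<And>c. c \<in> carrier_vec m \<Longrightarrow>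
      (\<forall>\<theta>\<in>{-\<tau>..0}. \<forall>i<n. lin_comb n \<tau> m e c \<theta> $ i = 0) \<Longrightarrow> c = 0\<^sub>v m"
  obtains H where "H \<in> carrier_mat m m" "H * form_matrix \<tau> m e (\<lambda>x. x) = 1\<^sub>m m"
proof -
  let ?G = "form_matrix \<tau> m e (\<lambda>x. x)"
  have G: "?G \<in> carrier_mat m m" by (simp add: form_matrix_def)
  have "det ?G \<noteq> 0"
  proof
    assume "det ?G = 0"
    then obtain c where c: "c \<in> carrier_vec m" "c \<noteq> 0\<^sub>v m" "?G *\<^sub>v c = 0\<^sub>v m"
      using det_0_iff_vec_prod_zero_field[OF G] by blast
    let ?x = "lin_comb n \<tau> m e c"
    have x: "?x \<in> C_space n \<tau>" using assms(2) by (rule lin_comb_C_space)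
    have "L2_inner \<tau> ?x ?x = 0"
      using quadratic_form_eq_form_matrix[OF linear_operator_id assms(2) c(1)] c by simp
    then have "c = 0\<^sub>v m"
      by (intro indep c(1) ballI allI impI L2_inner_self_eq_0D[OF assms(1) x])
    with c(2) show False ..
  qed
  then have "?G \<in> Units (ring_mat TYPE(real) m ())"
    by (rule det_non_zero_imp_unit[OF G])
  then show ?thesis
    using that unfolding Units_def ring_mat_def by auto
qed

section \<open>The monomial basis of the polynomial space\<close>

definition block_monomial :: "nat \<Rightarrow> real \<Rightarrow> nat \<Rightarrow> nat \<Rightarrow> real \<Rightarrow> real vec" where
  "block_monomial n \<tau> d a = (\<lambda>\<theta>\<in>{-\<tau>..0}. row (Zbar n d \<theta>) a)"

lemma Zbar_carrier: "Zbar n d \<theta> \<in> carrier_mat (n * (d + 1)) n"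
  by (simp add: Zbar_def kronecker_prod_def Z_def)

lemma Zbar_index:
  assumes "a < n * (d + 1)" "i < n"
  shows "Zbar n d \<theta> $$ (a, i) = (if a div (d + 1) = i then \<theta> ^ (a mod (d + 1)) else 0)"
proof -
  have "a div (d + 1) < n" using assms by (metis less_mult_imp_div_less)
  then show ?thesis using assms by (auto simp: Zbar_def kronecker_prod_def Z_def)
qed

lemma block_monomial_C_space:
  assumes "a < n * (d + 1)"
  shows "block_monomial n \<tau> d a \<in> C_space n \<tau>"
  unfolding block_monomial_def
proof (rule C_space_restrictI)
  show "row (Zbar n d \<theta>) a \<in> carrier_vec n" for \<theta>
    using Zbar_carrier by (metis row_carrier_vec assms)
  fix i assume i: "i < n"
  have "row (Zbar n d \<theta>) a $ i = (if a div (d + 1) = i then \<theta> ^ (a mod (d + 1)) else 0)" for \<theta>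
    using Zbar_index[OF assms i] Zbar_carrier[of n d \<theta>] assms i by simp
  then show "continuous_on {-\<tau>..0} (\<lambda>\<theta>. row (Zbar n d \<theta>) a $ i)"
    by (cases "a div (d + 1) = i") (auto intro!: continuous_intros)
qed

text \<open>
  The coefficients are stored in consecutive blocks of length \<open>d + 1\<close>, one for each component: this
  is the index order of \<open>I\<^sub>n \<otimes> Z\<^sub>d\<close>.
\<close>

definition block_poly :: "nat \<Rightarrow> real vec \<Rightarrow> nat \<Rightarrow> real poly" where
  "block_poly d c i = (\<Sum>j<d + 1. monom (c $ (i * (d + 1) + j)) j)"

lemma degree_block_poly: "degree (block_poly d c i) \<le> d"
  unfolding block_poly_def
  by (intro degree_sum_le) (auto intro: order_trans[OF degree_monom_le])

lemma coeff_block_poly: "j \<le> d \<Longrightarrow> coeff (block_poly d c i) j = c $ (i * (d + 1) + j)"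
  unfolding block_poly_def by (simp add: coeff_sum)

lemma lin_comb_block_monomial:
  assumes "\<theta> \<in> {-\<tau>..0}" "i < n"
  shows "lin_comb n \<tau> (n * (d + 1)) (block_monomial n \<tau> d) c \<theta> $ i = poly (block_poly d c i) \<theta>"
proof -
  define f where "f a = c $ a * (if a div (d + 1) = i then \<theta> ^ (a mod (d + 1)) else 0)" for a
  have "lin_comb n \<tau> (n * (d + 1)) (block_monomial n \<tau> d) c \<theta> $ i = sum f {..<n * (d + 1)}"
    using assms Zbar_carrier[of n d \<theta>]
    by (auto simp: lin_comb_def block_monomial_def Zbar_index f_def simp del: mult_Suc_right
        intro!: sum.cong)
  \<comment> \<open>Cut the index range into its blocks; only the block of component \<open>i\<close> contributes.\<close>
  also have "\<dots> = (\<Sum>k<n. sum f {k * (d + 1)..<k * (d + 1) + (d + 1)})"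
    by (rule sum.nat_group[symmetric])
  also have "\<dots> = (\<Sum>k<n. \<Sum>j<d + 1. f (k * (d + 1) + j))"
  proof (rule sum.cong[OF refl])
    fix k
    show "sum f {k * (d + 1)..<k * (d + 1) + (d + 1)} = (\<Sum>j<d + 1. f (k * (d + 1) + j))"
      using sum.shift_bounds_nat_ivl[of f 0 "k * (d + 1)" "d + 1"]
      by (simp only: atLeast0LessThan add_0_left add.commute)
  qed
  also have "\<dots> = (\<Sum>k<n. if k = i then \<Sum>j<d + 1. c $ (k * (d + 1) + j) * \<theta> ^ j else 0)"
  proof (rule sum.cong[OF refl])
    fix k
    have "f (k * (d + 1) + j) = (if k = i then c $ (k * (d + 1) + j) * \<theta> ^ j else 0)"
      if "j < d + 1" for j
    proof -
      have dm: "(k * (d + 1) + j) div (d + 1) = k" "(k * (d + 1) + j) mod (d + 1) = j"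
        using that div_mult_self3[of "d + 1" k j] mod_mult_self3[of k "d + 1" j] by simp_all
      show ?thesis unfolding f_def dm by simp
    qed
    then show "(\<Sum>j<d + 1. f (k * (d + 1) + j))
        = (if k = i then \<Sum>j<d + 1. c $ (k * (d + 1) + j) * \<theta> ^ j else 0)"
      by simp
  qed
  also have "\<dots> = poly (block_poly d c i) \<theta>"
    using assms(2) by (simp add: block_poly_def poly_sum poly_monom)
  finally show ?thesis .
qed

lemma lin_comb_block_monomial_poly_space:
  "lin_comb n \<tau> (n * (d + 1)) (block_monomial n \<tau> d) c \<in> poly_space n \<tau> d"
  unfolding poly_space_def
  by (intro CollectI conjI exI[of _ "block_poly d c"] lin_comb_C_space block_monomial_C_space)
    (use lin_comb_block_monomial degree_block_poly in auto)

lemma poly_space_eq_lin_comb: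
  assumes "x \<in> poly_space n \<tau> d"
  obtains c where "c \<in> carrier_vec (n * (d + 1))"
    "x = lin_comb n \<tau> (n * (d + 1)) (block_monomial n \<tau> d) c"
proof -
  from assms obtain q :: "nat \<Rightarrow> real poly" where x: "x \<in> C_space n \<tau>"
    and q: "\<And>i. i < n \<Longrightarrow> degree (q i) \<le> d"
      "\<And>i \<theta>. i < n \<Longrightarrow> \<theta> \<in> {-\<tau>..0} \<Longrightarrow> x \<theta> $ i = poly (q i) \<theta>"
    unfolding poly_space_def by blast
  define c where "c = vec (n * (d + 1)) (\<lambda>a. coeff (q (a div (d + 1))) (a mod (d + 1)))"
  have "block_poly d c i = q i" if i: "i < n" for i
  proof (rule poly_eqI)
    fix j
    show "coeff (block_poly d c i) j = coeff (q i) j"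
    proof (cases "j \<le> d")
      case True
      have "i * (d + 1) + j < (i + 1) * (d + 1)" using True by simp
      also have "\<dots> \<le> n * (d + 1)" using i by (intro mult_right_mono) auto
      finally have "i * (d + 1) + j < n * (d + 1)" .
      moreover have "(i * (d + 1) + j) div (d + 1) = i" "(i * (d + 1) + j) mod (d + 1) = j"
        using True div_mult_self3[of "d + 1" i j] mod_mult_self3[of i "d + 1" j] by simp_all
      ultimately show ?thesis unfolding coeff_block_poly[OF True] c_def by simp
    next
      case False
      then show ?thesis
        using q(1)[OF i] degree_block_poly[of d c i] by (simp add: coeff_eq_0)
    qed
  qed
  then have "x = lin_comb n \<tau> (n * (d + 1)) (block_monomial n \<tau> d) c"
    by (intro C_space_eqI[OF x] lin_comb_C_space block_monomial_C_space)
      (use q(2) lin_comb_block_monomial in auto)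
  moreover have "c \<in> carrier_vec (n * (d + 1))" by (simp add: c_def)
  ultimately show ?thesis by (rule that[rotated])
qed

text \<open>
  A vanishing combination makes each component polynomial zero on an interval of positive length,
  that is at infinitely many points, so all its coefficients are zero.
\<close>
lemma block_monomials_independent:
  assumes "\<tau> > 0" "c \<in> carrier_vec (n * (d + 1))"
    and "\<forall>\<theta>\<in>{-\<tau>..0}. \<forall>i<n. lin_comb n \<tau> (n * (d + 1)) (block_monomial n \<tau> d) c \<theta> $ i = 0"
  shows "c = 0\<^sub>v (n * (d + 1))"
proof (rule eq_vecI)
  fix a assume "a < dim_vec (0\<^sub>v (n * (d + 1)) :: real vec)"
  then have a: "a < n * (d + 1)" by simp
  define i where "i = a div (d + 1)"
  have i: "i < n" unfolding i_def using a by (metis less_mult_imp_div_less)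
  have "{-\<tau>..0} \<subseteq> {\<theta>. poly (block_poly d c i) \<theta> = 0}"
    using assms(3) i lin_comb_block_monomial by fastforce
  moreover have "infinite {-\<tau>..0}" using assms(1) by simp
  ultimately have "block_poly d c i = 0"
    using poly_roots_finite finite_subset by blast
  moreover have "a mod (d + 1) \<le> d"
    using mod_less_divisor[of "d + 1" a] by linarith
  ultimately have "c $ (i * (d + 1) + a mod (d + 1)) = 0"
    using coeff_block_poly[of "a mod (d + 1)" d c i] by simp
  moreover have "i * (d + 1) + a mod (d + 1) = a"
    unfolding i_def by (rule div_mult_mod_eq)
  ultimately show "c $ a = 0\<^sub>v (n * (d + 1)) $ a" using a by simp
qed (use assms(2) in simp)

section \<open>Polynomial kernels as forms in the moments\<close>

text \<open>
  The kernel separates: the integrand is \<open>(Zbar(\<theta>) x(\<theta>)) \<bullet> Q (Zbar(\<omega>) x(\<omega>))\<close>, a finite sum of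
  products of a function of \<open>\<theta>\<close> and a function of \<open>\<omega>\<close>. Each variable can therefore be integrated on
  its own, and the integrals of the entries of \<open>Zbar(\<theta>) x(\<theta>)\<close> are the moments of \<open>x\<close>.
\<close>
lemma double_integral_eq_moment_form:
  assumes Q: "Q \<in> carrier_mat (n * (d + 1)) (n * (d + 1))" and x: "x \<in> C_space n \<tau>"
  defines "w \<equiv> vec (n * (d + 1)) (\<lambda>a. L2_inner \<tau> (block_monomial n \<tau> d a) x)"
  shows "integral {-\<tau>..0} (\<lambda>\<omega>. integral {-\<tau>..0} (\<lambda>\<theta>.
      x \<theta> \<bullet> (transpose_mat (Zbar n d \<theta>) * Q * Zbar n d \<omega> *\<^sub>v x \<omega>))) = w \<bullet> (Q *\<^sub>v w)"
proof -
  let ?m = "n * (d + 1)"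
  define u where "u a \<theta> = block_monomial n \<tau> d a \<theta> \<bullet> x \<theta>" for a \<theta>
  have u_int: "u a integrable_on {-\<tau>..0}" if "a < ?m" for a
    unfolding u_def
    by (intro integrable_continuous_interval continuous_on_scalar_prod[OF _ x]
        block_monomial_C_space that)
  have w: "w $ a = integral {-\<tau>..0} (u a)" if "a < ?m" for a
    using that unfolding w_def L2_inner_def u_def by simp
  have integral_u: "integral {-\<tau>..0} (\<lambda>\<theta>. \<Sum>a<?m. K a * u a \<theta>) = (\<Sum>a<?m. K a * w $ a)" for K
  proof -
    have "integral {-\<tau>..0} (\<lambda>\<theta>. \<Sum>a<?m. K a * u a \<theta>)
        = (\<Sum>a<?m. integral {-\<tau>..0} (\<lambda>\<theta>. K a * u a \<theta>))"
      by (rule integral_sum) (auto intro!: integrable_on_mult_right u_int simp del: mult_Suc_right)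
    then show ?thesis using w by simp
  qed
  have kernel: "x \<theta> \<bullet> (transpose_mat (Zbar n d \<theta>) * Q * Zbar n d \<omega> *\<^sub>v x \<omega>)
      = (\<Sum>a<?m. (\<Sum>b<?m. Q $$ (a, b) * u b \<omega>) * u a \<theta>)"
    if "\<theta> \<in> {-\<tau>..0}" "\<omega> \<in> {-\<tau>..0}" for \<theta> \<omega>
  proof -
    have xt: "x \<theta> \<in> carrier_vec n" and xo: "x \<omega> \<in> carrier_vec n"
      using C_spaceD(1)[OF x] that by auto
    note Zt = Zbar_carrier[of n d \<theta>] and Zo = Zbar_carrier[of n d \<omega>]
    let ?z = "Zbar n d \<omega> *\<^sub>v x \<omega>"
    have z: "?z \<in> carrier_vec ?m" by (rule mult_mat_vec_carrier[OF Zo xo])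
    have q: "Q *\<^sub>v ?z \<in> carrier_vec ?m" by (rule mult_mat_vec_carrier[OF Q z])
    have ZQ: "transpose_mat (Zbar n d \<theta>) * Q \<in> carrier_mat n ?m"
      by (rule mult_carrier_mat[OF transpose_carrier_mat[THEN iffD2, OF Zt] Q])
    have "transpose_mat (Zbar n d \<theta>) * Q * Zbar n d \<omega> *\<^sub>v x \<omega>
        = transpose_mat (Zbar n d \<theta>) *\<^sub>v (Q *\<^sub>v ?z)"
      unfolding assoc_mult_mat_vec[OF ZQ Zo xo]
      by (rule assoc_mult_mat_vec[OF transpose_carrier_mat[THEN iffD2, OF Zt] Q z])
    then have "x \<theta> \<bullet> (transpose_mat (Zbar n d \<theta>) * Q * Zbar n d \<omega> *\<^sub>v x \<omega>)
        = (Zbar n d \<theta> *\<^sub>v x \<theta>) \<bullet> (Q *\<^sub>v ?z)"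
      using scalar_prod_transpose_mult_vec[OF Zt xt q] by simp
    also have "\<dots> = (\<Sum>a<?m. (Zbar n d \<theta> *\<^sub>v x \<theta>) $ a * (\<Sum>b<?m. Q $$ (a, b) * ?z $ b))"
      using Q Zo by (simp add: scalar_prod_def[of _ "Q *\<^sub>v _"] scalar_prod_def[of "row Q _"]
          atLeast0LessThan del: index_mult_mat_vec mult_Suc_right)
        (simp add: index_mult_mat_vec[of _ Q] scalar_prod_def[of "row Q _"]
          atLeast0LessThan del: index_mult_mat_vec mult_Suc_right)
    also have "\<dots> = (\<Sum>a<?m. u a \<theta> * (\<Sum>b<?m. Q $$ (a, b) * u b \<omega>))"
      using Zt Zo that by (simp add: u_def block_monomial_def del: mult_Suc_right)
    finally show ?thesis by (simp only: mult.commute)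
  qed
  have "integral {-\<tau>..0} (\<lambda>\<omega>. integral {-\<tau>..0} (\<lambda>\<theta>.
      x \<theta> \<bullet> (transpose_mat (Zbar n d \<theta>) * Q * Zbar n d \<omega> *\<^sub>v x \<omega>)))
    = integral {-\<tau>..0} (\<lambda>\<omega>. \<Sum>b<?m. (\<Sum>a<?m. w $ a * Q $$ (a, b)) * u b \<omega>)"
  proof (rule integral_cong)
    fix \<omega> assume o: "\<omega> \<in> {-\<tau>..0}"
    have "integral {-\<tau>..0} (\<lambda>\<theta>.
        x \<theta> \<bullet> (transpose_mat (Zbar n d \<theta>) * Q * Zbar n d \<omega> *\<^sub>v x \<omega>))
      = integral {-\<tau>..0} (\<lambda>\<theta>. \<Sum>a<?m. (\<Sum>b<?m. Q $$ (a, b) * u b \<omega>) * u a \<theta>)"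
      by (rule integral_cong) (rule kernel[OF _ o])
    also have "\<dots> = (\<Sum>a<?m. (\<Sum>b<?m. Q $$ (a, b) * u b \<omega>) * w $ a)"
      by (rule integral_u)
    also have "\<dots> = (\<Sum>a<?m. \<Sum>b<?m. w $ a * Q $$ (a, b) * u b \<omega>)"
      unfolding sum_distrib_right by (intro sum.cong refl) (simp only: ac_simps)
    also have "\<dots> = (\<Sum>b<?m. (\<Sum>a<?m. w $ a * Q $$ (a, b)) * u b \<omega>)"
      unfolding sum_distrib_right by (rule sum.swap)
    finally show "integral {-\<tau>..0} (\<lambda>\<theta>.
        x \<theta> \<bullet> (transpose_mat (Zbar n d \<theta>) * Q * Zbar n d \<omega> *\<^sub>v x \<omega>))
      = (\<Sum>b<?m. (\<Sum>a<?m. w $ a * Q $$ (a, b)) * u b \<omega>)" .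
  qed
  also have "\<dots> = (\<Sum>b<?m. (\<Sum>a<?m. w $ a * Q $$ (a, b)) * w $ b)"
    by (rule integral_u)
  also have "\<dots> = (\<Sum>a<?m. \<Sum>b<?m. w $ a * Q $$ (a, b) * w $ b)"
    unfolding sum_distrib_right by (rule sum.swap)
  also have "\<dots> = w \<bullet> (Q *\<^sub>v w)"
  proof -
    have "dim_vec w = ?m" by (simp add: w_def)
    then show ?thesis
      using Q by (simp add: scalar_prod_def atLeast0LessThan sum_distrib_left mult.assoc
          del: mult_Suc_right)
  qed
  finally show ?thesis .
qed

section \<open>The representing matrix\<close>

theorem mainTheorem4:
  fixes \<tau> :: real and n d :: nat
    and A :: "(real \<Rightarrow> real vec) \<Rightarrow> real \<Rightarrow> real vec"
  assumes "\<tau> > 0" and "n \<ge> 1"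
    and "compact_operator n \<tau> A"
    and "hermitian_operator n \<tau> A"
    and "positive_on \<tau> (poly_space n \<tau> d) A"
  shows "\<exists>Q \<in> sym_mats (n * (d + 1)). psd_mat Q \<and>
    (let k = (\<lambda>\<theta> \<omega>. transpose_mat (Zbar n d \<theta>) * Q * Zbar n d \<omega>) in
      \<forall>x \<in> poly_space n \<tau> d.
        L2_inner \<tau> x (A x) =
          integral {-\<tau>..0} (\<lambda>\<omega>. integral {-\<tau>..0} (\<lambda>\<theta>. x \<theta> \<bullet> (k \<theta> \<omega> *\<^sub>v x \<omega>))))"
proof -
  define m where "m = n * (d + 1)"
  define e where "e = block_monomial n \<tau> d"
  define G where "G = form_matrix \<tau> m e (\<lambda>x. x)"
  define M where "M = form_matrix \<tau> m e A"
  have e: "e a \<in> C_space n \<tau>" if "a < m" for a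
    using block_monomial_C_space that unfolding e_def m_def by blast
  have lin: "linear_operator n \<tau> A"
    using assms(4) unfolding hermitian_operator_def by blast
  have indep: "c = 0\<^sub>v m" if "c \<in> carrier_vec m"
    "\<forall>\<theta>\<in>{-\<tau>..0}. \<forall>i<n. lin_comb n \<tau> m e c \<theta> $ i = 0" for c
    using block_monomials_independent[OF assms(1)] that unfolding m_def e_def by blast
  obtain H where H: "H \<in> carrier_mat m m" and HG: "H * G = 1\<^sub>m m"
    unfolding G_def by (rule gram_matrix_left_inverse[where e = e, OF assms(1) e indep])
  have G: "G \<in> carrier_mat m m" and M: "M \<in> carrier_mat m m"
    by (simp_all add: G_def M_def form_matrix_def)
  \<comment> \<open>A left inverse suffices: taking the transpose on the left, rather than \<open>H\<close> itself, gives
    symmetry and positivity without knowing that \<open>H\<close> is symmetric.\<close>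
  define Q where "Q = transpose_mat H * (M * H)"
  have Q: "Q \<in> carrier_mat m m" using H M unfolding Q_def by simp
  have QF: "v \<bullet> (Q *\<^sub>v v) = (H *\<^sub>v v) \<bullet> (M *\<^sub>v (H *\<^sub>v v))" if v: "v \<in> carrier_vec m" for v :: "real vec"
  proof -
    have Hv: "H *\<^sub>v v \<in> carrier_vec m" and MHv: "M *\<^sub>v (H *\<^sub>v v) \<in> carrier_vec m"
      using H M v by (metis mult_mat_vec_carrier)+
    have "Q *\<^sub>v v = transpose_mat H *\<^sub>v (M *\<^sub>v (H *\<^sub>v v))"
      using H M v unfolding Q_def by (simp add: assoc_mult_mat_vec[of _ m m _ m])
    then show ?thesis using scalar_prod_transpose_mult_vec[OF H v MHv] by simp
  qed
  have form: "L2_inner \<tau> (lin_comb n \<tau> m e c) (A (lin_comb n \<tau> m e c)) = c \<bullet> (M *\<^sub>v c)"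
    if "c \<in> carrier_vec m" for c
    unfolding M_def by (rule quadratic_form_eq_form_matrix[OF lin e that])
  show ?thesis
    unfolding Let_def
  proof (intro bexI[of _ Q] conjI ballI)
    have "transpose_mat M = M"
      unfolding M_def by (rule form_matrix_symmetric[OF assms(4) e])
    then have "transpose_mat Q = Q"
      using H M unfolding Q_def
      by (simp add: transpose_mult[of _ m m _ m] assoc_mult_mat[of _ m m _ m _ m])
    then show "Q \<in> sym_mats (n * (d + 1))"
      using Q unfolding sym_mats_def m_def by simp
    show "psd_mat Q"
      unfolding psd_mat_def
    proof
      fix v :: "real vec" assume "v \<in> carrier_vec (dim_row Q)"
      then have v: "v \<in> carrier_vec m" using Q by simp
      have Hv: "H *\<^sub>v v \<in> carrier_vec m" using H v by (metis mult_mat_vec_carrier)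
      have "lin_comb n \<tau> m e (H *\<^sub>v v) \<in> poly_space n \<tau> d"
        unfolding m_def e_def by (rule lin_comb_block_monomial_poly_space)
      then have "0 \<le> L2_inner \<tau> (lin_comb n \<tau> m e (H *\<^sub>v v)) (A (lin_comb n \<tau> m e (H *\<^sub>v v)))"
        using assms(5) unfolding positive_on_def by blast
      then show "0 \<le> v \<bullet> (Q *\<^sub>v v)" using QF[OF v] form[OF Hv] by simp
    qed
    fix x assume "x \<in> poly_space n \<tau> d"
    then obtain c where c: "c \<in> carrier_vec m" and x: "x = lin_comb n \<tau> m e c"
      using poly_space_eq_lin_comb unfolding m_def e_def by metis
    have xC: "x \<in> C_space n \<tau>" unfolding x by (rule lin_comb_C_space[OF e])
    define w where "w = vec m (\<lambda>a. L2_inner \<tau> (e a) x)"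
    have w: "w = G *\<^sub>v c"
    proof (rule eq_vecI)
      show "dim_vec w = dim_vec (G *\<^sub>v c)" using G by (simp add: w_def)
      fix a assume "a < dim_vec (G *\<^sub>v c)"
      then have "a < m" using G by simp
      then show "w $ a = (G *\<^sub>v c) $ a"
        using form_matrix_mult_vec[OF linear_operator_id e c] unfolding w_def G_def x by simp
    qed
    have Hw: "H *\<^sub>v w = c"
      unfolding w using assoc_mult_mat_vec[OF H G c] HG c by simp
    have "L2_inner \<tau> x (A x) = w \<bullet> (Q *\<^sub>v w)"
      using QF[of w] form[OF c] Hw unfolding x w_def by simp
    also have "\<dots> = integral {-\<tau>..0} (\<lambda>\<omega>. integral {-\<tau>..0} (\<lambda>\<theta>.
        x \<theta> \<bullet> (transpose_mat (Zbar n d \<theta>) * Q * Zbar n d \<omega> *\<^sub>v x \<omega>)))"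
      unfolding w_def e_def m_def
      by (rule double_integral_eq_moment_form[OF Q[unfolded m_def] xC, symmetric])
    finally show "L2_inner \<tau> x (A x) = integral {-\<tau>..0} (\<lambda>\<omega>. integral {-\<tau>..0} (\<lambda>\<theta>.
        x \<theta> \<bullet> (transpose_mat (Zbar n d \<theta>) * Q * Zbar n d \<omega> *\<^sub>v x \<omega>)))" .
  qed
qed

end
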